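(* Let $\beta>1$ be a real number with $\log\beta/\log2\notin\mathbb{Q}$. For $k\ge0$ let $A_k(\beta)=\{i\in\mathbb{N}:\omega(\beta^{-k})_i=1\}$ be the set of positions of the digit $1$ in the binary expansion of $\beta^{-k}$, and let \[ W=\{k\in\mathbb{N}: A_k(\beta)\text{ contains no 3-term arithmetic progression}\}. \] Then $W$ has natural density $0$, i.e. $\#(W\cap[1,N])/N\to0$. If moreover $\log\beta/\log 2$ is badly approximable, then for every $\varepsilon>0$, $\#(W\cap[1,N])=O_\varepsilon(N^{\varepsilon})$.
   Context: For $x\in[0,1]$, its binary expansion is the sequence $\omega(x)=(\omega(x)_i)_{i\ge1}\in\{0,1\}^{\mathbb{N}}$ with $x=\sum_{i\ge1}\omega(x)_i2^{-i}$; when two such sequences exist, $\omega(x)$ is chosen to be the one with only finitely many $1$'s. A 3-term arithmetic progression in a set $A\subset\mathbb{N}$ means $a,a+d,a+2d\in A$ with $d\ge1$. A real number is badly approximable if the partial quotients of its continued fraction expansion are bounded. *)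

theory Defs
  imports Complex_Main "HOL-Library.Landau_Symbols"
begin

text \<open>i-th binary digit (i \<ge> 1) of x \<in> [0,1]; for x < 1 this is the expansion with
 finitely many 1's (the convention of the paper); x = 1 has the unique expansion 0.111...\<close>
definition bin_digit :: "real \<Rightarrow> nat \<Rightarrow> nat" where
  "bin_digit x i = (if x = 1 then 1 else nat (\<lfloor>2 ^ i * x\<rfloor> mod 2))"

definition digit_one_set :: "real \<Rightarrow> nat \<Rightarrow> nat set" where
  "digit_one_set \<beta> k = {i. 1 \<le> i \<and> bin_digit (inverse (\<beta> ^ k)) i = 1}"

definition has_3AP :: "nat set \<Rightarrow> bool" where
  "has_3AP A \<longleftrightarrow> (\<exists>a d. 1 \<le> d \<and> a \<in> A \<and> a + d \<in> A \<and> a + 2 * d \<in> A)"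

fun cf_rem :: "real \<Rightarrow> nat \<Rightarrow> real" where
  "cf_rem x 0 = x"
| "cf_rem x (Suc n) = 1 / frac (cf_rem x n)"

definition cf_pq :: "real \<Rightarrow> nat \<Rightarrow> int" where
  "cf_pq x n = \<lfloor>cf_rem x n\<rfloor>"

definition badly_approximable :: "real \<Rightarrow> bool" where
  "badly_approximable x \<longleftrightarrow> (\<exists>B. \<forall>n. \<bar>cf_pq x n\<bar> \<le> B)"

end

theory Submission
  imports Defs "HOL-Analysis.Kronecker_Approximation_Theorem" "HOL-Real_Asymp.Real_Asymp"
begin

text \<open>
  Write \<open>\<theta> = log 2 \<beta>\<close>. The positions of the digit 1 of \<open>inverse (\<beta> ^ k)\<close> are a translate of those of
  its mantissa \<open>y\<^sub>k = 2 powr frac (- (k * \<theta>))\<close>. By Roth's theorem at most \<open>C * 2 powr (\<epsilon> * n)\<close> subsets of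
  \<open>{..<n}\<close> contain no 3-term progression, so for \<open>k \<in> W\<close> the first \<open>n\<close> digits of \<open>y\<^sub>k\<close> take at most that
  many values, and two exponents with the same value satisfy \<open>\<bar>(k - k') * \<theta> - p\<bar> \<le> 4 / 2 ^ n\<close> for an
  integer \<open>p\<close>. Since \<open>\<theta>\<close> is irrational, each value is shared by a proportion \<open>O(2 powr (- n))\<close> of all
  exponents. If \<open>\<theta>\<close> is badly approximable, the choice \<open>2 ^ n \<approx> N\<close> lets each value occur only once up to
  \<open>N\<close>.

  Roth's theorem is proved by Szemeredi's argument: let \<open>\<delta>\<close> be the limiting density of extremal
  progression-free sets \<open>A\<close>. A dense \<open>A\<close> contains Hilbert cubes \<open>M\<close> of large dimension and bounded
  differences, and the reflections \<open>2 * m - x\<close> (\<open>m \<in> M\<close>, \<open>x \<in> A\<close>, \<open>x < m\<close>) avoid \<open>A\<close>. As the cube grows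
  by one difference \<open>d\<close>, the set of reflections is united with its translate by \<open>2 * d\<close>; at some stage it
  hardly grows, so its complement consists of few progressions with difference \<open>2 * d\<close>. On these \<open>A\<close> has
  density at most about \<open>\<delta>\<close>, although they miss a positive proportion of the interval.
\<close>

lemma has_3AP_mono: "has_3AP A \<Longrightarrow> A \<subseteq> B \<Longrightarrow> has_3AP B"
  unfolding has_3AP_def by blast

lemma has_3AP_affine_image:
  assumes "has_3AP B" "e \<ge> 1"
  shows "has_3AP ((\<lambda>j. s + j * e) ` B)"
proof -
  obtain a d where d: "1 \<le> d" "a \<in> B" "a + d \<in> B" "a + 2 * d \<in> B"
    using assms(1) unfolding has_3AP_def by blast
  have eq: "s + (a + d) * e = (s + a * e) + d * e" "s + (a + 2 * d) * e = (s + a * e) + 2 * (d * e)"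
    by (simp_all add: algebra_simps)
  have "1 \<le> d * e" using d(1) assms(2) by simp
  moreover have "s + a * e \<in> (\<lambda>j. s + j * e) ` B" using d(2) by blast
  moreover have "(s + a * e) + d * e \<in> (\<lambda>j. s + j * e) ` B"
    unfolding eq(1)[symmetric] using d(3) by blast
  moreover have "(s + a * e) + 2 * (d * e) \<in> (\<lambda>j. s + j * e) ` B"
    unfolding eq(2)[symmetric] using d(4) by blast
  ultimately show ?thesis unfolding has_3AP_def by blast
qed

subsection \<open>Roth's theorem\<close>

definition roth_number :: "nat \<Rightarrow> nat" where
  "roth_number n = Max (card ` {A. A \<subseteq> {..<n} \<and> \<not> has_3AP A})"

lemma card_le_roth_number:
  assumes "A \<subseteq> {..<n}" "\<not> has_3AP A"
  shows "card A \<le> roth_number n"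
  unfolding roth_number_def using assms by (intro Max_ge) auto

lemma roth_number_attained:
  obtains A where "A \<subseteq> {..<n}" "\<not> has_3AP A" "card A = roth_number n"
proof -
  have "{} \<in> {A. A \<subseteq> {..<n} \<and> \<not> has_3AP A}"
    by (auto simp: has_3AP_def)
  then have "roth_number n \<in> card ` {A. A \<subseteq> {..<n} \<and> \<not> has_3AP A}"
    unfolding roth_number_def by (intro Max_in) auto
  then obtain A where "A \<subseteq> {..<n}" "\<not> has_3AP A" "roth_number n = card A"
    by (elim imageE CollectE conjE)
  then show ?thesis using that[of A] by simp
qed

text \<open>Progression-freeness is affine invariant, so the set of indices \<open>j\<close> with
  \<open>s + j * e\<close> in \<open>A\<close> competes for \<open>roth_number l\<close>, whatever
  \<open>s\<close> and \<open>e\<close> are.\<close>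

lemma card_Int_progression_le:
  assumes "\<not> has_3AP A" "e \<ge> 1"
  shows "card (A \<inter> (\<lambda>j. s + j * e) ` {..<l}) \<le> roth_number l"
proof -
  define B where "B = {j \<in> {..<l}. s + j * e \<in> A}"
  have eq: "A \<inter> (\<lambda>j. s + j * e) ` {..<l} = (\<lambda>j. s + j * e) ` B"
    by (auto simp: B_def)
  have "\<not> has_3AP B"
    using assms(1) has_3AP_mono[OF has_3AP_affine_image[OF _ assms(2)], of B s A]
    by (auto simp: B_def)
  then have "card B \<le> roth_number l"
    by (intro card_le_roth_number) (auto simp: B_def)
  then show ?thesis
    unfolding eq using card_image_le[of B "\<lambda>j. s + j * e"] by (simp add: B_def)
qed

lemma card_Int_interval_le:
  assumes "\<not> has_3AP A"
  shows "card (A \<inter> {s..<s + l}) \<le> roth_number l"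
proof -
  have "(\<lambda>j. s + j * 1) ` {..<l} = {s..<s + l}"
  proof -
    have "x \<in> (\<lambda>j. s + j * 1) ` {..<l}" if "x \<in> {s..<s + l}" for x
      using that by (intro image_eqI[of _ _ "x - s"]) auto
    then show ?thesis by auto
  qed
  then show ?thesis using card_Int_progression_le[OF assms, of 1 s l] by simp
qed

lemma roth_number_add_le: "roth_number (m + n) \<le> roth_number m + roth_number n"
proof -
  obtain A where A: "A \<subseteq> {..<m + n}" "\<not> has_3AP A" "card A = roth_number (m + n)"
    by (rule roth_number_attained)
  have "card A = card ((A \<inter> {0..<0 + m}) \<union> (A \<inter> {m..<m + n}))"
    using A(1) by (intro arg_cong[of _ _ card]) auto
  also have "\<dots> \<le> card (A \<inter> {0..<0 + m}) + card (A \<inter> {m..<m + n})"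
    by (rule card_Un_le)
  finally show ?thesis
    using card_Int_interval_le[OF A(2), of 0 m] card_Int_interval_le[OF A(2), of m n] A(3)
    by linarith
qed

lemma roth_number_le: "roth_number n \<le> n"
proof -
  obtain A where A: "A \<subseteq> {..<n}" "\<not> has_3AP A" "card A = roth_number n"
    by (rule roth_number_attained)
  then show ?thesis using card_mono[OF _ A(1)] by simp
qed

lemma roth_number_mult_add_le: "roth_number (q * n + r) \<le> q * roth_number n + roth_number r"
proof (induction q)
  case 0
  show ?case by simp
next
  case (Suc q)
  have "Suc q * n + r = n + (q * n + r)"
    by simp
  then have "roth_number (Suc q * n + r) \<le> roth_number n + roth_number (q * n + r)"
    using roth_number_add_le[of n "q * n + r"] by argo
  also have "\<dots> \<le> roth_number n + (q * roth_number n + roth_number r)"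
    by (rule add_left_mono) (rule Suc)
  also have "\<dots> = Suc q * roth_number n + roth_number r"
    by simp
  finally show ?case .
qed

text \<open>By subadditivity of \<open>roth_number\<close> this infimum is also the limit (Fekete).
  Index 0 is left out because division by zero yields 0 and would force the infimum to be 0.\<close>

definition roth_density :: real where
  "roth_density = (INF n\<in>{1..}. real (roth_number n) / real n)"

lemma roth_density_le:
  assumes "n \<ge> 1"
  shows "roth_density \<le> real (roth_number n) / real n"
  unfolding roth_density_def
  by (rule cINF_lower) (use assms in \<open>auto intro!: bdd_belowI[of _ 0]\<close>)

lemma roth_density_mult_le: "roth_density * real n \<le> real (roth_number n)"
  using roth_density_le[of n] by (cases "n = 0") (auto simp: field_simps)

lemma roth_density_nonneg: "0 \<le> roth_density"
  unfolding roth_density_def by (rule cINF_greatest) auto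

lemma roth_density_le_1: "roth_density \<le> 1"
  using roth_density_le[of 1] roth_number_le[of 1] by simp

text \<open>Fekete's argument: cut \<open>{..<m}\<close> into blocks of a length \<open>n\<close>
  whose ratio nearly attains the infimum. The incomplete block costs at most \<open>n\<close>, which
  serves as \<open>c\<close>.\<close>

lemma roth_number_le_linear:
  assumes "\<eta> > 0"
  obtains c where "\<And>m. real (roth_number m) \<le> (roth_density + \<eta>) * real m + real c"
proof -
  have "\<exists>n\<in>{1..}. real (roth_number n) / real n < roth_density + \<eta>"
  proof (rule ccontr)
    assume "\<not> ?thesis"
    then have "roth_density + \<eta> \<le> roth_density"
      by (subst (2) roth_density_def, intro cINF_greatest) (auto simp: not_less)
    then show False using assms by simp
  qed
  then obtain n where n: "n \<ge> 1" "real (roth_number n) \<le> (roth_density + \<eta>) * n"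
    by (auto simp: field_simps intro: less_imp_le)
  have "real (roth_number m) \<le> (roth_density + \<eta>) * real m + real n" for m
  proof -
    have m: "m = (m div n) * n + m mod n" by simp
    have "roth_number m \<le> (m div n) * roth_number n + n"
      using roth_number_mult_add_le[of "m div n" n "m mod n"] roth_number_le[of "m mod n"]
        mod_less_divisor[of n m] n(1) by fastforce
    then have "real (roth_number m) \<le> real (m div n) * real (roth_number n) + real n"
      by (metis of_nat_add of_nat_le_iff of_nat_mult)
    also have "\<dots> \<le> real (m div n) * ((roth_density + \<eta>) * n) + real n"
      using n(2) by (intro add_right_mono mult_left_mono) auto
    also have "\<dots> = (roth_density + \<eta>) * real ((m div n) * n) + real n" by simp
    also have "\<dots> \<le> (roth_density + \<eta>) * real m + real n"
      using roth_density_nonneg assms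
      by (intro add_right_mono mult_left_mono) (auto simp del: of_nat_mult)
    finally show ?thesis .
  qed
  then show ?thesis using that by blast
qed

section \<open>Hilbert cubes with bounded differences in dense sets\<close>

text \<open>Elements of \<open>S\<close> with no further element of \<open>S\<close> within distance \<open>T\<close> lie in distinct
  blocks of length \<open>T\<close>; all the others have one of \<open>T\<close> differences.\<close>

lemma popular_difference:
  fixes S :: "nat set"
  assumes "S \<subseteq> {..<M}" "T \<ge> 1"
  obtains d where "1 \<le> d" "d \<le> T" "card S \<le> T * card {x \<in> S. x + d \<in> S} + (M div T + 1)"
proof -
  have fin: "finite S" using assms(1) finite_subset by blast
  define I where "I = {x \<in> S. \<forall>d\<in>{1..T}. x + d \<notin> S}"
  define U where "U = (\<Union>d\<in>{1..T}. {x \<in> S. x + d \<in> S})"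
  have "inj_on (\<lambda>x. x div T) I"
  proof -
    have "\<not> x < y" if "x \<in> I" "y \<in> I" "x div T = y div T" for x y
    proof
      assume "x < y"
      have "y < x + T"
        using div_mult_mod_eq[of x T, unfolded that(3)] div_mult_mod_eq[of y T]
          mod_less_divisor[of T y] assms(2)
        by linarith
      then have "y - x \<in> {1..T}" "x + (y - x) \<in> S"
        using \<open>x < y\<close> that by (auto simp: I_def)
      then show False using that(1) by (auto simp: I_def)
    qed
    then show ?thesis by (intro inj_onI) (metis linorder_neqE_nat)
  qed
  moreover have "(\<lambda>x. x div T) ` I \<subseteq> {..M div T}"
    using assms(1) by (auto simp: I_def intro!: div_le_mono)
  ultimately have I: "card I \<le> M div T + 1"
    by (metis Suc_eq_plus1 card_atMost card_inj_on_le finite_atMost)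
  define f where "f d = card {x \<in> S. x + d \<in> S}" for d
  have "Max (f ` {1..T}) \<in> f ` {1..T}"
    using assms(2) by (intro Max_in) auto
  then obtain d where d: "Max (f ` {1..T}) = f d" "d \<in> {1..T}"
    by (elim imageE)
  have "card U \<le> (\<Sum>d\<in>{1..T}. f d)"
    unfolding U_def f_def by (rule card_UN_le) auto
  also have "\<dots> \<le> T * f d"
    using sum_bounded_above[of "{1..T}" f "f d"] d(1) Max_ge[of "f ` {1..T}"] by simp
  finally have "card U \<le> T * f d" .
  moreover have "S = U \<union> I" by (auto simp: U_def I_def)
  then have "card S \<le> card U + card I" using card_Un_le[of U I] by simp
  ultimately have "card S \<le> T * f d + (M div T + 1)" using I by linarith
  then show ?thesis using that[of d] d(2) by (simp add: f_def)
qed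

text \<open>The head of the list is the difference added last, so the suffixes of \<open>ds\<close>
  give an increasing chain of subcubes.\<close>

fun hilbert_cube :: "nat \<Rightarrow> nat list \<Rightarrow> nat set" where
  "hilbert_cube a [] = {a}"
| "hilbert_cube a (d # ds) = hilbert_cube a ds \<union> (\<lambda>x. x + d) ` hilbert_cube a ds"

text \<open>Induction on the dimension: for a popular difference \<open>d\<close>, the
  \<open>x\<close> in \<open>S\<close> with \<open>x + d\<close> in \<open>S\<close> are still
  dense, and a cube among them together with its translate by \<open>d\<close> lies in
  \<open>S\<close>. The bound \<open>D\<close> does not depend on \<open>M\<close>.\<close>

lemma hilbert_cube_in_dense_set:
  fixes \<alpha> :: real
  assumes "\<alpha> > 0"
  shows "\<exists>D M0. \<forall>M\<ge>M0. \<forall>S\<subseteq>{..<M}. \<alpha> * M \<le> card S \<longrightarrow>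
    (\<exists>a ds. length ds = K \<and> (\<forall>d\<in>set ds. 1 \<le> d \<and> d \<le> D) \<and> hilbert_cube a ds \<subseteq> S)"
  using assms
proof (induction K arbitrary: \<alpha>)
  case 0
  have "\<exists>a ds. length ds = 0 \<and> (\<forall>d\<in>set ds. 1 \<le> d \<and> d \<le> (0::nat)) \<and> hilbert_cube a ds \<subseteq> S"
    if "M \<ge> 1" "\<alpha> * real M \<le> real (card S)" for M :: nat and S
  proof -
    have "card S > 0" using 0 that by (smt (verit) mult_pos_pos of_nat_0_less_iff of_nat_1 of_nat_mono)
    then obtain a where "a \<in> S" by fastforce
    then show ?thesis by (intro exI[of _ a] exI[of _ "[]"]) auto
  qed
  then show ?case by blast
next
  case (Suc K)
  \<comment> \<open>For \<open>M \<ge> T \<ge> 3 / \<alpha>\<close>, the summands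
    \<open>M div T\<close> and 1 each cost at most a third of \<open>\<alpha> * M\<close>. The last
    third is shared by \<open>T\<close> differences, hence the density
    \<open>\<alpha> / (3 * T)\<close>.\<close>
  define T where "T = Suc (nat \<lceil>3 / \<alpha>\<rceil>)"
  have T: "real T \<ge> 3 / \<alpha>" "T \<ge> 1"
    unfolding T_def by linarith+
  have "\<alpha> / (3 * T) > 0" using Suc.prems T by simp
  from Suc.IH[OF this] obtain D M0 where IH:
    "\<And>M S. M \<ge> M0 \<Longrightarrow> S \<subseteq> {..<M} \<Longrightarrow> \<alpha> / (3 * T) * M \<le> card S \<Longrightarrow>
      \<exists>a ds. length ds = K \<and> (\<forall>d\<in>set ds. 1 \<le> d \<and> d \<le> D) \<and> hilbert_cube a ds \<subseteq> S"
    by meson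
  have "\<exists>a ds. length ds = Suc K \<and> (\<forall>d\<in>set ds. 1 \<le> d \<and> d \<le> max D T) \<and> hilbert_cube a ds \<subseteq> S"
    if M: "M \<ge> max M0 T" and S: "S \<subseteq> {..<M}" "\<alpha> * real M \<le> real (card S)" for M :: nat and S
  proof -
    obtain d where d: "1 \<le> d" "d \<le> T" "card S \<le> T * card {x \<in> S. x + d \<in> S} + (M div T + 1)"
      using popular_difference[OF S(1) T(2)] .
    define S' where "S' = {x \<in> S. x + d \<in> S}"
    have "real (M div T) \<le> real M / real T" by (rule of_nat_div_le_of_nat)
    also have "\<dots> \<le> \<alpha> * M / 3"
      using T Suc.prems mult_right_mono[of "3/\<alpha>" "real T" "real M * \<alpha>"] by (simp add: field_simps)
    finally have 1: "real (M div T) \<le> \<alpha> * M / 3" .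
    have "3 / \<alpha> \<le> real M" using T(1) M by linarith
    then have 2: "1 \<le> \<alpha> * M / 3" using Suc.prems by (simp add: field_simps)
    have "real (card S) \<le> real T * card S' + (real (M div T) + 1)"
      using d(3) unfolding S'_def[symmetric] by (metis of_nat_1 of_nat_add of_nat_le_iff of_nat_mult)
    then have "\<alpha> * M / 3 \<le> real T * card S'" using 1 2 S(2) by argo
    then have "\<alpha> / (3 * T) * M \<le> card S'" using T(2) by (simp add: field_simps)
    moreover have "S' \<subseteq> {..<M}" using S(1) by (auto simp: S'_def)
    ultimately obtain a ds where "length ds = K" "\<forall>d\<in>set ds. 1 \<le> d \<and> d \<le> D" "hilbert_cube a ds \<subseteq> S'"
      using IH[of M S'] M by auto
    then show ?thesis using d(1,2)
      by (intro exI[of _ a] exI[of _ "d # ds"]) (auto simp: S'_def)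
  qed
  then show ?case by blast
qed

section \<open>Slow growth, runs and reflections\<close>

text \<open>The increments telescope. Used backwards: if \<open>F ds\<close> is small, some step of
  the chain adds fewer than \<open>c\<close> elements.\<close>

lemma slow_growth_step:
  fixes F :: "'a list \<Rightarrow> 'b set"
  assumes "\<And>d vs. F vs \<subseteq> F (d # vs)" "\<And>vs. finite (F vs)"
    and "\<And>us d vs. ds = us @ d # vs \<Longrightarrow> c \<le> card (F (d # vs) - F vs)"
  shows "length ds * c \<le> card (F ds)"
  using assms(3)
proof (induction ds)
  case (Cons d ds)
  have "length ds * c \<le> card (F ds)"
    using Cons.prems by (intro Cons.IH) (metis append_Cons)
  moreover have "card (F (d # ds)) = card (F ds) + card (F (d # ds) - F ds)"
    using assms(1,2) by (metis card_Diff_subset card_mono le_add_diff_inverse)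
  ultimately show ?case using Cons.prems[of "[]" d ds] by simp
qed simp

text \<open>\<open>C\<close> splits into maximal runs with difference \<open>e\<close>; the last cardinality counts their starting points.\<close>

lemma card_Int_le_runs:
  fixes \<rho> c :: real
  assumes "\<not> has_3AP A" "e \<ge> 1" "0 \<le> c" and roth: "\<And>l. real (roth_number l) \<le> \<rho> * l + c"
    and "finite C"
  shows "real (card (A \<inter> C)) \<le> \<rho> * card C + c * card {x \<in> C. \<forall>y\<in>C. y + e \<noteq> x}"
  using assms(5)
proof (induction C rule: finite_psubset_induct)
  case (psubset C)
  show ?case
  proof (cases "C = {}")
    case False
    define s where "s = Min C"
    have s: "s \<in> C" "\<And>y. y \<in> C \<Longrightarrow> s \<le> y"
      using False psubset.hyps by (auto simp: s_def)
    have ex: "\<exists>l. s + l * e \<notin> C"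
    proof (rule ccontr)
      assume "\<not> ?thesis"
      then have "range (\<lambda>l. s + l * e) \<subseteq> C" by auto
      moreover have "inj (\<lambda>l. s + l * e)" using assms(2) by (auto simp: inj_def)
      ultimately show False
        using psubset.hyps by (meson finite_subset infinite_UNIV_nat range_inj_infinite)
    qed
    define l where "l = (LEAST l. s + l * e \<notin> C)"
    define R where "R = (\<lambda>j. s + j * e) ` {..<l}"
    have l: "s + l * e \<notin> C" unfolding l_def using ex by (rule LeastI_ex)
    have RC: "R \<subseteq> C" unfolding R_def l_def using not_less_Least by blast
    have "l > 0" using l s(1) by (cases l) auto
    then have sR: "s \<in> R" by (force simp: R_def)
    have cardR: "card R = l"
      unfolding R_def using assms(2) by (subst card_image) (auto simp: inj_on_def)
    let ?st = "\<lambda>C. {x \<in> C. \<forall>y\<in>C. y + e \<noteq> x}"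
    have "s \<in> ?st C" using s assms(2) by fastforce
    \<comment> \<open>Removing the run \<open>R\<close> creates no new starting point: the successor
      of a member of \<open>R\<close> lies in \<open>R\<close> or equals \<open>s + l * e\<close>,
      which is outside \<open>C\<close>.\<close>
    moreover have "?st (C - R) \<subseteq> ?st C - {s}"
    proof
      fix x assume x: "x \<in> ?st (C - R)"
      have "y + e \<noteq> x" if "y \<in> C" for y
      proof
        assume yx: "y + e = x"
        then have "y \<in> R" using x that by auto
        then obtain j where j: "j < l" "y = s + j * e" by (auto simp: R_def)
        then have "x = s + Suc j * e" using yx by simp
        moreover have "s + Suc j * e \<notin> C - R"
          using j(1) l by (cases "Suc j = l") (auto simp: R_def simp del: mult_Suc)
        ultimately show False using x by blast
      qed
      then show "x \<in> ?st C - {s}" using x sR by auto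
    qed
    moreover have fst: "finite (?st C)" using psubset.hyps by simp
    ultimately have st: "card (?st (C - R)) + 1 \<le> card (?st C)"
      by (metis (no_types, lifting) card_Suc_Diff1 card_mono finite_Diff Suc_eq_plus1 Suc_le_mono)
    have "C - R \<subset> C" using sR RC by auto
    from psubset.IH[OF this]
    have IH: "real (card (A \<inter> (C - R))) \<le> \<rho> * card (C - R) + c * card (?st (C - R))" .
    have cC: "card C = card (C - R) + l"
      using RC psubset.hyps cardR by (metis card_Diff_subset card_mono finite_subset le_add_diff_inverse2)
    have "card (A \<inter> C) = card ((A \<inter> (C - R)) \<union> (A \<inter> R))"
      using RC by (intro arg_cong[of _ _ card]) auto
    also have "\<dots> \<le> card (A \<inter> (C - R)) + card (A \<inter> R)"
      by (rule card_Un_le)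
    finally have "card (A \<inter> C) \<le> card (A \<inter> (C - R)) + card (A \<inter> R)" .
    moreover have "card (A \<inter> R) \<le> roth_number l"
      unfolding R_def by (rule card_Int_progression_le[OF assms(1,2)])
    ultimately have "real (card (A \<inter> C)) \<le> real (card (A \<inter> (C - R))) + (\<rho> * l + c)"
      using roth[of l] by linarith
    also have "\<dots> \<le> \<rho> * card C + c * (card (?st (C - R)) + 1)"
      using IH cC by (simp add: algebra_simps)
    also have "\<dots> \<le> \<rho> * card C + c * card (?st C)"
      using st assms(3) by (intro add_left_mono mult_left_mono) linarith+
    finally show ?thesis .
  qed simp
qed

text \<open>For \<open>x < m\<close>, \<open>z\<close> is the third term of the progression
  \<open>x\<close>, \<open>m\<close>, \<open>z\<close>. The additive form avoids truncated
  subtraction.\<close>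

definition reflections :: "nat set \<Rightarrow> nat set \<Rightarrow> nat set" where
  "reflections X M = {z. \<exists>m\<in>M. \<exists>x\<in>X. z + x = 2 * m}"

text \<open>Moving \<open>m\<close> by \<open>d\<close> moves \<open>2 * m - x\<close> by
  \<open>2 * d\<close>; \<open>x \<le> m\<close> prevents truncation.\<close>

lemma reflections_Un_shift:
  assumes "\<And>x m. x \<in> X \<Longrightarrow> m \<in> M \<Longrightarrow> x \<le> m"
  shows "reflections X (M \<union> (\<lambda>m. m + d) ` M) =
    reflections X M \<union> (\<lambda>z. z + 2 * d) ` reflections X M"
proof -
  have "z \<in> (\<lambda>z. z + 2 * d) ` reflections X M" if "m \<in> M" "x \<in> X" "z + x = 2 * (m + d)" for z m x
  proof -
    have "z = (2 * m - x) + 2 * d" "2 * m - x \<in> reflections X M"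
      using assms[OF that(2,1)] that unfolding reflections_def by force+
    then show ?thesis by blast
  qed
  moreover have "z + 2 * d \<in> reflections X ((\<lambda>m. m + d) ` M)" if "z \<in> reflections X M" for z
    using that unfolding reflections_def by force
  ultimately show ?thesis unfolding reflections_def by fastforce
qed

lemma finite_hilbert_cube: "finite (hilbert_cube a ds)"
  by (induction ds) auto

lemma hilbert_cube_nonempty: "hilbert_cube a ds \<noteq> {}"
  by (induction ds) auto

lemma hilbert_cube_append: "hilbert_cube a vs \<subseteq> hilbert_cube a (us @ vs)"
  by (induction us) auto

lemma finite_reflections:
  assumes "finite M"
  shows "finite (reflections X M)"
proof (rule finite_subset)
  show "reflections X M \<subseteq> (\<Union>m\<in>M. {..2 * m})"
  proof
    fix z assume "z \<in> reflections X M"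
    then obtain m x where "m \<in> M" "z + x = 2 * m" unfolding reflections_def by blast
    then show "z \<in> (\<Union>m\<in>M. {..2 * m})" by (intro UN_I[of m]) auto
  qed
qed (use assms in auto)

text \<open>Reflection in the single point \<open>m\<close> is already injective on
  \<open>X\<close>.\<close>

lemma card_reflections_ge:
  assumes "finite M" "m \<in> M" "\<And>x. x \<in> X \<Longrightarrow> x \<le> m"
  shows "card X \<le> card (reflections X M)"
proof (rule card_inj_on_le)
  show "inj_on (\<lambda>x. 2 * m - x) X"
  proof (rule inj_onI)
    fix x y assume "x \<in> X" "y \<in> X" "2 * m - x = 2 * m - y"
    then show "x = y" using assms(3)[of x] assms(3)[of y] by linarith
  qed
  show "(\<lambda>x. 2 * m - x) ` X \<subseteq> reflections X M"
  proof (rule image_subsetI)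
    fix x assume "x \<in> X"
    then show "2 * m - x \<in> reflections X M"
      unfolding reflections_def using assms(2) assms(3)[of x]
      by (intro CollectI bexI[of _ m] bexI[of _ x]) auto
  qed
qed (rule finite_reflections[OF assms(1)])

lemma reflections_disjoint:
  assumes "\<not> has_3AP A" "X \<subseteq> A" "M \<subseteq> A" "\<And>x m. x \<in> X \<Longrightarrow> m \<in> M \<Longrightarrow> x < m"
  shows "reflections X M \<inter> A = {}"
proof (rule ccontr)
  assume "\<not> ?thesis"
  then obtain z x m where z: "z \<in> A" "m \<in> M" "x \<in> X" "z + x = 2 * m"
    unfolding reflections_def by blast
  have xm: "x < m" using assms(4) z by blast
  then have "x + (m - x) = m" "x + 2 * (m - x) = z" using z(4) by auto
  then have "1 \<le> m - x \<and> x \<in> A \<and> x + (m - x) \<in> A \<and> x + 2 * (m - x) \<in> A"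
    using xm z assms(2,3) by auto
  then show False using assms(1) unfolding has_3AP_def by blast
qed

section \<open>Szemeredi's argument for the limiting density\<close>

lemma roth_density_eq_0: "roth_density = 0"
proof (rule ccontr)
  define \<delta> where "\<delta> = roth_density"
  assume "roth_density \<noteq> 0"
  then have \<delta>: "0 < \<delta>" "\<delta> \<le> 1"
    using roth_density_nonneg roth_density_le_1 by (auto simp: \<delta>_def)
  define \<eta> where "\<eta> = \<delta>\<^sup>2 / 20"
  have \<delta>2: "0 < \<delta>\<^sup>2" "\<delta>\<^sup>2 \<le> \<delta>"
    using \<delta> by (auto simp: power2_eq_square mult_left_le)
  have \<eta>: "0 < \<eta>" "20 * \<eta> = \<delta>\<^sup>2" "20 * \<eta> \<le> \<delta>"
    using \<delta>2 by (auto simp: \<eta>_def)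
  obtain c where c: "\<And>m. real (roth_number m) \<le> (\<delta> + \<eta>) * real m + real c"
    using roth_number_le_linear[OF \<eta>(1)] unfolding \<delta>_def by blast
  \<comment> \<open>So many steps that the new runs cost at most
    \<open>4 * c / K * q \<le> \<delta>\<^sup>2 / 4 * q\<close> in the final inequality.\<close>
  define K where "K = Suc (nat \<lceil>16 * c / \<delta>\<^sup>2\<rceil>)"
  have K: "real K \<ge> 16 * c / \<delta>\<^sup>2" "K > 0"
    unfolding K_def by linarith+
  obtain D M0 where cube: "\<And>M S. M \<ge> M0 \<Longrightarrow> S \<subseteq> {..<M} \<Longrightarrow> \<delta> / 4 * M \<le> card S \<Longrightarrow>
      \<exists>a ds. length ds = K \<and> (\<forall>d\<in>set ds. 1 \<le> d \<and> d \<le> D) \<and> hilbert_cube a ds \<subseteq> S"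
    using hilbert_cube_in_dense_set[of "\<delta> / 4" K] \<delta>(1) by (metis zero_less_divide_iff zero_less_numeral)
  \<comment> \<open>\<open>q\<close> lets the cube lemma apply at length \<open>2 * q\<close> and
    makes \<open>\<delta>\<^sup>2 * q\<close> dominate all terms independent of
    \<open>q\<close>.\<close>
  define q where "q = M0 + Suc (nat \<lceil>(8 * real c * (1 + D) + 1) / \<delta>\<^sup>2\<rceil>)"
  have q: "real q \<ge> (8 * real c * (1 + D) + 1) / \<delta>\<^sup>2" "q \<ge> M0" "q > 0"
    unfolding q_def by linarith+
  have q\<delta>2: "8 * real c * (1 + D) + 1 \<le> \<delta>\<^sup>2 * q"
    using q(1) \<delta>2(1) by (simp add: field_simps)
  have "\<delta>\<^sup>2 * q \<le> \<delta> * q" using \<delta>2(2) by (intro mult_right_mono) auto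
  moreover have "8 * real c * 1 \<le> 8 * real c * (1 + real D)"
    by (intro mult_left_mono) auto
  ultimately have q\<delta>: "8 * real c \<le> \<delta> * q" using q\<delta>2 by simp
  have q\<eta>: "20 * (\<eta> * q) \<le> \<delta> * q"
    using mult_right_mono[OF \<eta>(3), of "real q"] by (simp add: mult.assoc)

  obtain A where A: "A \<subseteq> {..<4 * q}" "\<not> has_3AP A" "card A = roth_number (4 * q)"
    by (rule roth_number_attained)
  have finA: "finite A" using A(1) finite_subset by blast
  have cardA: "4 * (\<delta> * q) \<le> card A"
    using roth_density_mult_le[of "4 * q"] A(3) by (simp add: \<delta>_def)
  \<comment> \<open>With \<open>A0\<close> in the first and \<open>A1\<close> in the second quarter,
    \<open>x < m\<close> always holds and \<open>2 * m - x\<close> stays below \<open>4 * q\<close>.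
    Both are dense because the other three quarters hold at most about
    \<open>3 * (\<delta> + \<eta>) * q\<close> elements of \<open>A\<close>.\<close>
  define A0 where "A0 = A \<inter> {..<q}"
  define A1 where "A1 = A \<inter> {q..<2 * q}"
  have roth: "real (card (A \<inter> {s..<s + l})) \<le> (\<delta> + \<eta>) * real l + real c" for s l
    using card_Int_interval_le[OF A(2), of s l] c[of l] by linarith
  have "card A = card (A0 \<union> (A \<inter> {q..<q + 3 * q}))"
    using A(1) by (intro arg_cong[of _ _ card]) (auto simp: A0_def)
  also have "\<dots> \<le> card A0 + card (A \<inter> {q..<q + 3 * q})"
    by (rule card_Un_le)
  finally have "real (card A) \<le> real (card A0) + ((\<delta> + \<eta>) * real (3 * q) + c)"
    using roth[of q "3 * q"] by linarith
  then have cardA0: "\<delta> * q - 3 * (\<eta> * q) - c \<le> card A0"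
    using cardA by (simp add: algebra_simps)
  have "card A = card (A1 \<union> ((A \<inter> {0..<0 + q}) \<union> (A \<inter> {2 * q..<2 * q + 2 * q})))"
    using A(1) by (intro arg_cong[of _ _ card]) (auto simp: A1_def)
  also have "\<dots> \<le> card A1 + (card (A \<inter> {0..<0 + q}) + card (A \<inter> {2 * q..<2 * q + 2 * q}))"
    by (meson add_left_mono card_Un_le order_trans)
  finally have "real (card A) \<le> real (card A1) + (((\<delta> + \<eta>) * real q + c) + ((\<delta> + \<eta>) * real (2 * q) + c))"
    using roth[of 0 q] roth[of "2 * q" "2 * q"] by linarith
  then have "\<delta> * q - 3 * (\<eta> * q) - 2 * c \<le> card A1"
    using cardA by (simp add: algebra_simps)
  then have "\<delta> / 4 * real (2 * q) \<le> card A1"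
    using q\<delta> q\<eta> by simp
  moreover have "A1 \<subseteq> {..<2 * q}" by (auto simp: A1_def)
  ultimately obtain a ds where ds: "length ds = K" "\<forall>d\<in>set ds. 1 \<le> d \<and> d \<le> D"
    and sub: "hilbert_cube a ds \<subseteq> A1"
    using cube[of "2 * q" A1] q(2) by auto

  define N where "N vs = reflections A0 (hilbert_cube a vs)" for vs
  have finN: "finite (N vs)" for vs
    unfolding N_def by (intro finite_reflections finite_hilbert_cube)
  have monoN: "N vs \<subseteq> N (d # vs)" for d vs
    unfolding N_def reflections_def by auto
  have N4q: "N vs \<subseteq> {..<4 * q}" if "hilbert_cube a vs \<subseteq> A1" for vs
    using that unfolding N_def reflections_def A1_def by fastforce
  \<comment> \<open>Pigeonhole: the sets \<open>N\<close> grow in \<open>K\<close> steps inside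
    \<open>{..<4 * q}\<close>.\<close>
  obtain us d vs where vs: "ds = us @ d # vs" "card (N (d # vs) - N vs) \<le> 4 * q div K"
  proof (rule ccontr)
    assume "\<not> thesis"
    note found = that
    have "Suc (4 * q div K) \<le> card (N (d # vs) - N vs)" if "ds = us @ d # vs" for us d vs
      using found[OF that] \<open>\<not> thesis\<close> by linarith
    then have "length ds * Suc (4 * q div K) \<le> card (N ds)"
      by (intro slow_growth_step monoN finN)
    also have "\<dots> \<le> 4 * q"
      using card_mono[OF _ N4q[OF sub]] by simp
    finally have "K * Suc (4 * q div K) \<le> 4 * q" using ds(1) by simp
    then show False using dividend_less_times_div[OF K(2), of "4 * q"] by simp
  qed
  have d: "1 \<le> d" "d \<le> D" using ds(2) vs(1) by auto
  have cvs: "hilbert_cube a vs \<subseteq> A1"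
    using hilbert_cube_append[of a vs "us @ [d]"] sub vs(1) by auto
  have less: "x < m" if "x \<in> A0" "m \<in> hilbert_cube a vs" for x m
    using that cvs by (auto simp: A0_def A1_def)
  have shift: "N (d # vs) = N vs \<union> (\<lambda>z. z + 2 * d) ` N vs"
    unfolding N_def hilbert_cube.simps using less
    by (intro reflections_Un_shift) (auto simp: less_imp_le)
  obtain m where m: "m \<in> hilbert_cube a vs" using hilbert_cube_nonempty by blast
  have "card A0 \<le> card (N vs)"
    unfolding N_def using m less by (intro card_reflections_ge finite_hilbert_cube) (auto intro: less_imp_le)
  then have cardN: "\<delta> * q - 3 * (\<eta> * q) - c \<le> card (N vs)" using cardA0 by linarith
  have "N vs \<inter> A = {}"
    unfolding N_def using A(2) less cvs by (intro reflections_disjoint) (auto simp: A0_def A1_def)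
  define C where "C = {..<4 * q} - N vs"
  have AC: "A \<inter> C = A" using A(1) \<open>N vs \<inter> A = {}\<close> by (auto simp: C_def)
  have cardC: "real (card C) = 4 * real q - card (N vs)"
    using N4q[OF cvs] card_mono[OF _ N4q[OF cvs]] unfolding C_def
    by (subst card_Diff_subset) (auto simp: finN of_nat_diff)
  define st where "st = {x \<in> C. \<forall>y\<in>C. y + 2 * d \<noteq> x}"
  \<comment> \<open>For a starting point \<open>x \<ge> 2 * d\<close>, the point
    \<open>x - 2 * d\<close> is missing from \<open>C\<close>, hence lies in \<open>N vs\<close>. So
    \<open>x\<close> is one of the few points new in \<open>N (d # vs)\<close>.\<close>
  have "st \<subseteq> {..<2 * d} \<union> (N (d # vs) - N vs)"
  proof
    fix x assume x: "x \<in> st"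
    show "x \<in> {..<2 * d} \<union> (N (d # vs) - N vs)"
    proof (cases "x < 2 * d")
      case False
      then have "x - 2 * d \<notin> C" using x by (auto simp: st_def)
      then have "x - 2 * d \<in> N vs" using x by (auto simp: st_def C_def)
      then have "x \<in> N (d # vs)" unfolding shift using False
        by (intro UnI2 image_eqI[of _ _ "x - 2 * d"]) auto
      then show ?thesis using x by (auto simp: st_def C_def)
    qed simp
  qed
  then have "card st \<le> card ({..<2 * d} \<union> (N (d # vs) - N vs))"
    by (intro card_mono) (auto simp: finN)
  also have "\<dots> \<le> 2 * D + 4 * q div K"
    using card_Un_le[of "{..<2 * d}" "N (d # vs) - N vs"] vs(2) d(2) by simp
  finally have "real (card st) \<le> 2 * real D + real (4 * q div K)" by linarith
  also have "real (4 * q div K) \<le> 4 * real q / K"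
    using of_nat_div_le_of_nat[of "4 * q" K] by simp
  finally have cardst: "real (card st) \<le> 2 * real D + 4 * real q / K" by simp
  have "real (card (A \<inter> C)) \<le> (\<delta> + \<eta>) * card C + real c * card st"
    unfolding st_def by (rule card_Int_le_runs[OF A(2)]) (use c d(1) in \<open>auto simp: C_def\<close>)
  then have "real (card A) \<le> (\<delta> + \<eta>) * card C + real c * card st"
    by (simp only: AC)
  also have "\<dots> \<le> (\<delta> + \<eta>) * (4 * q - (\<delta> * q - 3 * (\<eta> * q) - c)) + c * (2 * real D + 4 * real q / K)"
    using cardN cardC cardst \<delta> \<eta> by (intro add_mono mult_left_mono) auto
  also have "\<dots> = (\<delta> + \<eta>) * (4 - \<delta> + 3 * \<eta>) * q + (\<delta> + \<eta>) * c + 2 * c * D + 4 * c / K * q"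
    by (simp add: algebra_simps)
  finally have main: "4 * \<delta> * q \<le>
      (\<delta> + \<eta>) * (4 - \<delta> + 3 * \<eta>) * q + (\<delta> + \<eta>) * c + 2 * c * D + 4 * c / K * q"
    using cardA by simp
  \<comment> \<open>After cancelling \<open>4 * \<delta> * q\<close> the gain is
    \<open>\<delta>\<^sup>2 * q\<close>. The terms in \<open>\<eta>\<close> take back at most 9/20
    of it and the runs 1/4; the remaining 3/10 exceeds the bounded terms.\<close>
  have "(\<delta> + \<eta>) * (4 - \<delta> + 3 * \<eta>) = 4 * \<delta> - \<delta>\<^sup>2 + 2 * (\<delta> * \<eta>) + 4 * \<eta> + 3 * (\<eta> * \<eta>)"
    by (simp add: algebra_simps power2_eq_square)
  moreover have "\<delta> * \<eta> \<le> \<eta>" "\<eta> * \<eta> \<le> \<eta>"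
    using \<delta> \<eta> by (auto intro!: mult_left_le_one_le mult_left_le)
  ultimately have "(\<delta> + \<eta>) * (4 - \<delta> + 3 * \<eta>) \<le> 4 * \<delta> - 11 / 20 * \<delta>\<^sup>2"
    using \<eta>(2) by linarith
  then have 1: "(\<delta> + \<eta>) * (4 - \<delta> + 3 * \<eta>) * q \<le> (4 * \<delta> - 11 / 20 * \<delta>\<^sup>2) * q"
    by (rule mult_right_mono) simp
  have "4 * c / K \<le> \<delta>\<^sup>2 / 4" using K \<delta>2(1) by (simp add: field_simps)
  then have 2: "4 * c / K * q \<le> \<delta>\<^sup>2 / 4 * q" by (rule mult_right_mono) simp
  have 3: "(\<delta> + \<eta>) * c \<le> 2 * real c" using \<delta> \<eta> by (intro mult_right_mono) auto
  have "8 * real c + 8 * (real c * D) + 1 \<le> \<delta>\<^sup>2 * q" using q\<delta>2 by (simp add: algebra_simps)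
  moreover have "4 * \<delta> * q \<le> 4 * \<delta> * q - 11 / 20 * (\<delta>\<^sup>2 * q) + 2 * real c + 2 * (real c * D) + 1 / 4 * (\<delta>\<^sup>2 * q)"
    using main 1 2 3 by (simp add: algebra_simps)
  moreover have "0 \<le> real c * real D" by simp
  ultimately show False by linarith
qed

theorem Roth:
  assumes "\<delta> > 0"
  obtains c where "\<And>n A. A \<subseteq> {..<n} \<Longrightarrow> \<not> has_3AP A \<Longrightarrow> real (card A) \<le> \<delta> * real n + real c"
proof -
  obtain c where "\<And>m. real (roth_number m) \<le> \<delta> * real m + real c"
    using roth_number_le_linear[OF assms] by (auto simp: roth_density_eq_0)
  then show ?thesis
    using that[of c] card_le_roth_number by (meson of_nat_le_iff order_trans)
qed

subsection \<open>Counting sets without 3-term progressions\<close>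

definition ap_free_sets :: "nat \<Rightarrow> nat set set" where
  "ap_free_sets n = {S. S \<subseteq> {..<n} \<and> \<not> has_3AP S}"

lemma finite_ap_free_sets: "finite (ap_free_sets n)"
  unfolding ap_free_sets_def by simp

lemma sum_Pow_power_card:
  fixes x :: "'b :: comm_semiring_1"
  assumes "finite A"
  shows "(\<Sum>S\<in>Pow A. x ^ card S) = (1 + x) ^ card A"
  using prod_add[OF assms, of "\<lambda>_. x" "\<lambda>_. 1"] by (simp add: add.commute)

text \<open>Weight each set \<open>S\<close> by \<open>x ^ card S\<close> with
  \<open>x \<le> 1\<close>. All subsets of \<open>{..<n}\<close> together weigh
  \<open>(1 + x) ^ n\<close>, while by Roth's theorem each progression-free one weighs at least
  \<open>x powr (\<delta> * n + c)\<close>. First \<open>x\<close>, then \<open>\<delta>\<close>, is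
  chosen so that each costs half of \<open>\<epsilon>\<close>.\<close>

lemma card_ap_free_sets_le:
  assumes "\<epsilon> > 0"
  obtains C where "C > 0" "\<And>n. real (card (ap_free_sets n)) \<le> C * 2 powr (\<epsilon> * n)"
proof -
  define x :: real where "x = min 1 (2 powr (\<epsilon> / 2) - 1)"
  have x: "0 < x" "x \<le> 1" "1 + x \<le> 2 powr (\<epsilon> / 2)"
    using assms by (auto simp: x_def)
  define L where "L = - log 2 x"
  have L: "0 \<le> L" "x = 2 powr (- L)" using x by (auto simp: L_def)
  define \<delta> where "\<delta> = \<epsilon> / (2 * (L + 1))"
  have \<delta>: "0 < \<delta>" "L * \<delta> \<le> \<epsilon> / 2"
    using assms L by (auto simp: \<delta>_def field_simps)
  obtain c where c: "\<And>n A. A \<subseteq> {..<n} \<Longrightarrow> \<not> has_3AP A \<Longrightarrow> real (card A) \<le> \<delta> * real n + real c"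
    using Roth[OF \<delta>(1)] by blast
  have "real (card (ap_free_sets n)) \<le> 2 powr (L * c) * 2 powr (\<epsilon> * n)" for n
  proof -
    have "x powr (\<delta> * n + c) \<le> x ^ card S" if "S \<in> ap_free_sets n" for S
      using c[of S n] that x powr_mono'[of "real (card S)" "\<delta> * n + c" x]
      by (simp add: ap_free_sets_def powr_realpow)
    then have "real (card (ap_free_sets n)) * x powr (\<delta> * n + c) \<le> (\<Sum>S\<in>ap_free_sets n. x ^ card S)"
      using sum_mono[of "ap_free_sets n" "\<lambda>_. x powr (\<delta> * n + c)" "\<lambda>S. x ^ card S"] by simp
    also have "\<dots> \<le> (\<Sum>S\<in>Pow {..<n}. x ^ card S)"
      using x(1) by (intro sum_mono2) (auto simp: ap_free_sets_def)
    also have "\<dots> = (1 + x) ^ n" by (simp add: sum_Pow_power_card)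
    also have "\<dots> \<le> (2 powr (\<epsilon> / 2)) ^ n" using x by (intro power_mono) auto
    also have "\<dots> = 2 powr (\<epsilon> / 2 * n)" by (simp add: powr_realpow[symmetric] powr_powr)
    finally have "real (card (ap_free_sets n)) \<le> 2 powr (\<epsilon> / 2 * n) * x powr (- (\<delta> * n + c))"
      using x(1) by (subst powr_minus) (simp add: field_simps)
    also have "\<dots> = 2 powr (\<epsilon> / 2 * n + L * \<delta> * n + L * c)"
      unfolding L(2) powr_powr powr_add[symmetric] by (simp add: algebra_simps)
    also have "\<dots> \<le> 2 powr (\<epsilon> * n + L * c)"
      using mult_right_mono[OF \<delta>(2), of "real n"] by (simp add: field_simps)
    finally show ?thesis by (simp add: powr_add mult.commute)
  qed
  then show ?thesis using that[of "2 powr (L * c)"] by simp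
qed

subsection \<open>Badly approximable numbers\<close>

lemma cf_rem_irrational:
  assumes "\<theta> \<notin> \<rat>"
  shows "cf_rem \<theta> n \<notin> \<rat>"
proof (induction n)
  case (Suc n)
  have "cf_rem \<theta> n \<in> \<rat>" if "1 / frac (cf_rem \<theta> n) \<in> \<rat>"
  proof -
    have "inverse (1 / frac (cf_rem \<theta> n)) \<in> \<rat>" using that by (rule Rats_inverse)
    then have "frac (cf_rem \<theta> n) + of_int \<lfloor>cf_rem \<theta> n\<rfloor> \<in> \<rat>"
      by (intro Rats_add) auto
    then show ?thesis by (simp add: frac_def)
  qed
  then show ?case using Suc by auto
qed (use assms in simp)

lemma cf_rem_Suc:
  assumes "\<theta> \<notin> \<rat>"
  shows "cf_rem \<theta> n = of_int (cf_pq \<theta> n) + 1 / cf_rem \<theta> (Suc n)" "1 < cf_rem \<theta> (Suc n)"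
proof -
  have "cf_rem \<theta> n \<notin> \<int>"
    using cf_rem_irrational[OF assms, of n] Ints_subset_Rats by blast
  then have "0 < frac (cf_rem \<theta> n)" by (simp add: frac_gt_0_iff)
  then show "1 < cf_rem \<theta> (Suc n)" using frac_lt_1[of "cf_rem \<theta> n"] by simp
  show "cf_rem \<theta> n = of_int (cf_pq \<theta> n) + 1 / cf_rem \<theta> (Suc n)"
    by (simp add: cf_pq_def frac_def)
qed

text \<open>Each remainder after the first is a partial quotient, at least 1, plus the reciprocal of
  the next remainder, which is below \<open>B + 1\<close>. This keeps it away from 1.\<close>

lemma cf_rem_Suc_bounds:
  assumes "\<theta> \<notin> \<rat>" "\<And>n. \<bar>cf_pq \<theta> n\<bar> \<le> B"
  shows "cf_rem \<theta> n < B + 1" "(real_of_int B + 2) / (real_of_int B + 1) \<le> cf_rem \<theta> (Suc n)" "1 \<le> B"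
proof -
  have less: "cf_rem \<theta> n < B + 1" for n
    using assms(2)[of n] unfolding cf_pq_def by linarith
  have pq: "1 \<le> cf_pq \<theta> (Suc n)"
    using cf_rem_Suc(2)[OF assms(1), of n] by (simp add: cf_pq_def del: cf_rem.simps)
  then show "1 \<le> B" using assms(2)[of "Suc n"] by linarith
  then have B: "0 < real_of_int B + 1" by simp
  have "1 / (real_of_int B + 1) \<le> 1 / cf_rem \<theta> (Suc (Suc n))"
    using less[of "Suc (Suc n)"] cf_rem_Suc(2)[OF assms(1), of "Suc n"]
    by (intro divide_left_mono) (auto simp del: cf_rem.simps)
  moreover have "1 \<le> real_of_int (cf_pq \<theta> (Suc n))" using pq by simp
  ultimately have "1 + 1 / (real_of_int B + 1) \<le> cf_rem \<theta> (Suc n)"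
    using cf_rem_Suc(1)[OF assms(1), of "Suc n"] by linarith
  then show "(real_of_int B + 2) / (real_of_int B + 1) \<le> cf_rem \<theta> (Suc n)"
    using B by (simp add: field_simps del: cf_rem.simps)
  show "cf_rem \<theta> n < B + 1" by (rule less)
qed

text \<open>With \<open>x = a + 1 / x'\<close>, \<open>y' = 1 / (a + y)\<close> and \<open>p' = p - j * a\<close>, the quantity
  \<open>\<bar>(j * x - p) * (p + j * y)\<bar> / (x + y)\<close> is unchanged under passing from \<open>(x, y, j, p)\<close> to
  \<open>(x', y', p', j)\<close>, so no constant is lost along the Euclidean descent on \<open>(j, p)\<close>.\<close>

lemma cf_form_lower_bound:
  fixes j p :: int and y :: real
  assumes \<theta>: "\<theta> \<notin> \<rat>" and B: "\<And>n. \<bar>cf_pq \<theta> n\<bar> \<le> B"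
    and "1 \<le> j" "1 \<le> p" "0 \<le> y" "y \<le> 1" "1 \<le> y + cf_pq \<theta> n"
  shows "cf_rem \<theta> n + y \<le> (B + 2)\<^sup>2 * \<bar>(j * cf_rem \<theta> n - p) * (p + j * y)\<bar>"
  using assms(3-)
proof (induction "nat j" arbitrary: j p y n rule: less_induct)
  case less
  define a x x' where "a = cf_pq \<theta> n" and "x = cf_rem \<theta> n" and "x' = cf_rem \<theta> (Suc n)"
  note defs = a_def[symmetric] x_def[symmetric] x'_def[symmetric]
  define p' where "p' = p - j * a"
  define b where "b = real_of_int B + 1"
  have b: "2 \<le> b" "x < b" "x' < b" "(b + 1) / b \<le> x'"
    using cf_rem_Suc_bounds(1)[OF \<theta> B, of n] cf_rem_Suc_bounds(2)[OF \<theta> B, of n]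
      cf_rem_Suc_bounds(3)[OF \<theta> B] cf_rem_Suc_bounds(1)[OF \<theta> B, of "Suc n"]
    by (auto simp: b_def add.commute defs simp del: cf_rem.simps)
  have x: "x = a + 1 / x'" "1 < x'"
    using cf_rem_Suc[OF \<theta>, of n] by (auto simp: defs simp del: cf_rem.simps)
  have L: "j * x - p = j / x' - p'"
    by (simp add: x(1) p'_def algebra_simps)
  have j: "1 \<le> real_of_int j" and "1 \<le> real_of_int p" using less.prems by auto
  then have M: "1 \<le> p + j * y" using less.prems(3) by (simp add: add_increasing2)
  \<comment> \<open>The descent may stop once the linear factor is at least
    \<open>1 / (b + 1)\<close>: the other factor is at least 1 and \<open>x + y \<le> b + 1\<close>,
    which is where the square of \<open>B + 2\<close> comes from.\<close>
  have base: ?case if L1: "1 / (b + 1) \<le> \<bar>j * x - p\<bar>"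
  proof -
    have "1 / (b + 1) * 1 \<le> \<bar>j * x - p\<bar> * (p + j * y)"
      using L1 M b by (intro mult_mono) auto
    also have "\<dots> = \<bar>(j * x - p) * (p + j * y)\<bar>"
      using M by (simp add: abs_mult)
    finally have "(b + 1)\<^sup>2 * (1 / (b + 1)) \<le> (b + 1)\<^sup>2 * \<bar>(j * x - p) * (p + j * y)\<bar>"
      by (intro mult_left_mono) auto
    moreover have "(b + 1)\<^sup>2 * (1 / (b + 1)) = b + 1" using b by (simp add: power2_eq_square)
    moreover have "x + y \<le> b + 1" using b less.prems(4) by simp
    ultimately show ?thesis by (simp add: defs b_def add.commute)
  qed
  \<comment> \<open>By \<open>L\<close> the linear factor is \<open>j / x' - p'\<close>. Outside
    \<open>0 < p' < j\<close> its terms cannot nearly cancel; inside, the descent continues with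
    \<open>p'\<close> in place of \<open>j\<close>.\<close>
  consider "p' \<le> 0" | "j \<le> p'" | "1 \<le> p'" "p' < j" by linarith
  then show ?case
  proof cases
    case 1
    have "1 / b \<le> j / x'" using b x j by (intro frac_le) auto
    moreover have "1 / (b + 1) \<le> 1 / b" using b by (simp add: field_simps)
    moreover have "real_of_int p' \<le> 0" using 1 by simp
    ultimately have "1 / (b + 1) \<le> \<bar>j / x' - p'\<bar>" by linarith
    then show ?thesis unfolding L[symmetric] by (rule base)
  next
    case 2
    have "1 / x' \<le> b / (b + 1)" using b x by (simp add: field_simps)
    then have "j * (1 / x') \<le> j * (b / (b + 1))" using j by (intro mult_left_mono) auto
    moreover have "1 / (b + 1) \<le> j * (1 / (b + 1))" using j b by (simp add: divide_right_mono)
    moreover have "j * (b / (b + 1)) + j * (1 / (b + 1)) = j * ((b + 1) / (b + 1))"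
      by (simp only: distrib_left add_divide_distrib)
    moreover have "(b + 1) / (b + 1) = 1" using b by simp
    ultimately have "1 / (b + 1) \<le> j - j / x'" by simp
    moreover have "real_of_int j \<le> p'" using 2 by simp
    ultimately have "1 / (b + 1) \<le> \<bar>j / x' - p'\<bar>" by linarith
    then show ?thesis unfolding L[symmetric] by (rule base)
  next
    case 3
    define y' where "y' = 1 / (a + y)"
    have ay: "1 \<le> a + y" using less.prems(5) by (simp add: defs add.commute)
    have y': "0 < y'" "y' \<le> 1" "p + j * y = (j + p' * y') / y'" "1 / y' = a + y"
      using ay by (auto simp: y'_def p'_def field_simps)
    have "1 \<le> cf_pq \<theta> (Suc n)" using x(2) by (simp add: cf_pq_def defs del: cf_rem.simps)
    then have "x' + y' \<le> (b + 1)\<^sup>2 * \<bar>(p' * x' - j) * (j + p' * y')\<bar>"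
      using less.hyps[of p' j y' "Suc n"] 3 less.prems(1) y'(1,2)
      by (simp add: defs b_def add.commute del: cf_rem.simps)
    then have "(x' + y') / (x' * y') \<le> (b + 1)\<^sup>2 * \<bar>(p' * x' - j) * (j + p' * y')\<bar> / (x' * y')"
      using x(2) y'(1) by (intro divide_right_mono) auto
    also have "\<dots> = (b + 1)\<^sup>2 * \<bar>((p' * x' - j) / x') * ((j + p' * y') / y')\<bar>"
      using x(2) y'(1) by (simp add: abs_mult)
    also have "(p' * x' - j) / x' = - (j * x - p)"
      unfolding L using x(2) by (simp add: field_simps)
    also have "(j + p' * y') / y' = p + j * y" using y'(3) by simp
    also have "(x' + y') / (x' * y') = 1 / x' + 1 / y'"
      using x(2) y'(1) by (simp add: field_simps)
    also have "\<dots> = x + y" using x(1) y'(4) by simp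
    also have "\<bar>- (j * x - p) * (p + j * y)\<bar> = \<bar>(j * x - p) * (p + j * y)\<bar>"
      by (simp only: mult_minus_left abs_minus_cancel)
    finally show ?thesis by (simp add: defs b_def add.commute)
  qed
qed

text \<open>If \<open>p\<close> is within 1 of \<open>j * \<theta>\<close>, the factor
  \<open>p + j\<close> of the quadratic form has order \<open>j\<close>, so a bound for the form
  gives one for the linear factor.\<close>

lemma badly_approximable_lower_bound:
  assumes "\<theta> \<notin> \<rat>" "0 < \<theta>" "badly_approximable \<theta>"
  obtains c where "0 < c" "\<And>j p. 1 \<le> j \<Longrightarrow> c / real j \<le> \<bar>real j * \<theta> - of_int p\<bar>"
proof -
  obtain B where B: "\<And>n. \<bar>cf_pq \<theta> n\<bar> \<le> B"
    using assms(3) unfolding badly_approximable_def by blast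
  have B1: "1 \<le> B" using cf_rem_Suc_bounds(3)[OF assms(1) B] .
  define E where "E = (B + 2)\<^sup>2 * (\<theta> + 2)"
  have E: "0 < E" unfolding E_def using B1 assms(2) by (intro mult_pos_pos) auto
  define c where "c = min (min 1 \<theta>) (\<theta> / E)"
  have c: "0 < c" "c \<le> 1" "c \<le> \<theta>" "c * E \<le> \<theta>"
    using assms(2) E by (auto simp: c_def min_def field_simps)
  have "c / real j \<le> \<bar>real j * \<theta> - of_int p\<bar>" if j: "1 \<le> j" for j :: nat and p :: int
  proof -
    have j': "1 \<le> real j" using j by simp
    have cj: "c / real j \<le> c" using c(1) j' by (simp add: field_simps)
    consider "1 \<le> \<bar>real j * \<theta> - of_int p\<bar>" | "p \<le> 0" | "1 \<le> p" "\<bar>real j * \<theta> - of_int p\<bar> < 1"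
      by linarith
    then show ?thesis
    proof cases
      case 1
      then show ?thesis using c cj by linarith
    next
      case 2
      have "1 * \<theta> \<le> real j * \<theta>" using j' assms(2) by (intro mult_right_mono) auto
      then show ?thesis using 2 c(3) cj by linarith
    next
      case 3
      \<comment> \<open>The form is used with \<open>y = 1\<close>, since the first partial quotient
        may be 0 and \<open>1 \<le> y + cf_pq \<theta> 0\<close> is required.\<close>
      have "0 \<le> cf_pq \<theta> 0" using assms(2) by (simp add: cf_pq_def)
      then have "\<theta> + 1 \<le> (B + 2)\<^sup>2 * \<bar>(real j * \<theta> - p) * (p + real j)\<bar>"
        using cf_form_lower_bound[OF assms(1) B, of "int j" p 1 0] j 3 by simp
      also have "\<dots> = (B + 2)\<^sup>2 * (p + real j) * \<bar>real j * \<theta> - p\<bar>"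
        using 3 by (simp add: abs_mult)
      also have "\<dots> \<le> (B + 2)\<^sup>2 * (real j * (\<theta> + 2)) * \<bar>real j * \<theta> - p\<bar>"
      proof (intro mult_right_mono mult_left_mono)
        have "p + real j \<le> real j * \<theta> + 1 + real j" using 3 by linarith
        also have "\<dots> \<le> real j * (\<theta> + 2)" using j' by (simp add: algebra_simps)
        finally show "p + real j \<le> real j * (\<theta> + 2)" .
      qed auto
      finally have "\<theta> \<le> E * (real j * \<bar>real j * \<theta> - p\<bar>)"
        by (simp add: E_def mult_ac)
      then have "E * c \<le> E * (real j * \<bar>real j * \<theta> - p\<bar>)" using c(4) by (simp add: mult.commute)
      then have "c \<le> real j * \<bar>real j * \<theta> - p\<bar>" using E by simp
      then show ?thesis using j' by (simp add: field_simps)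
    qed
  qed
  then show ?thesis by (intro that[OF c(1)])
qed

subsection \<open>Orbits of irrational rotations\<close>

text \<open>The shifted sets \<open>K + i * r\<close> (\<open>i < P\<close>) are disjoint once \<open>r * \<theta>\<close> is at distance between \<open>\<rho>\<close>
  and \<open>2 * \<rho>\<close> from an integer.\<close>

lemma card_close_orbit_times:
  assumes \<theta>: "\<theta> \<notin> \<rat>" and "0 < \<rho>" and "4 * \<rho> * real P \<le> 1"
  obtains J where "\<And>N K. K \<subseteq> {1..N} \<Longrightarrow>
    (\<And>k k'. k \<in> K \<Longrightarrow> k' \<in> K \<Longrightarrow> \<exists>p::int. \<bar>(real k - real k') * \<theta> - p\<bar> \<le> \<rho>) \<Longrightarrow> P * card K \<le> N + J"
proof -
  define M where "M = Suc (nat \<lceil>1 / \<rho>\<rceil>)"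
  have M: "M > 0" "1 / \<rho> \<le> real M" unfolding M_def by linarith+
  obtain h q where q: "0 < q" "\<bar>of_int q * \<theta> - of_int h\<bar> < 1 / M"
    using Dirichlet_approx[OF M(1), of \<theta>] by blast
  define g where "g = \<bar>of_int q * \<theta> - of_int h\<bar>"
  have "1 / real M \<le> \<rho>" using M assms(2) by (simp add: field_simps)
  then have g\<rho>: "g < \<rho>" using q(2) by (simp add: g_def)
  have "g \<noteq> 0"
  proof
    assume "g = 0"
    then have "\<theta> = of_int h / of_int q" using q(1) by (simp add: g_def field_simps)
    then show False using \<theta> by simp
  qed
  then have g0: "0 < g" by (simp add: g_def)
  \<comment> \<open>The first multiple of \<open>g\<close> beyond \<open>\<rho>\<close>; it is at
    most \<open>2 * \<rho>\<close> because \<open>g < \<rho>\<close>.\<close>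
  define s where "s = nat \<lfloor>\<rho> / g\<rfloor> + 1"
  have "0 \<le> \<rho> / g" using g0 assms(2) by simp
  then have "real s \<le> \<rho> / g + 1" "\<rho> / g < real s"
    unfolding s_def by linarith+
  then have s: "\<rho> < real s * g" "real s * g \<le> 2 * \<rho>"
    using g0 g\<rho> by (auto simp: field_simps)
  define r where "r = s * nat q"
  have r: "real r * \<theta> = real s * (of_int q * \<theta> - of_int h) + of_int (int s * h)"
    using q(1) by (simp add: r_def algebra_simps)
  have "P * card K \<le> N + (P * r + 1)" if K: "K \<subseteq> {1..N}"
    and close: "\<And>k k'. k \<in> K \<Longrightarrow> k' \<in> K \<Longrightarrow> \<exists>p::int. \<bar>(real k - real k') * \<theta> - p\<bar> \<le> \<rho>" for N K
  proof -
    have "inj_on (\<lambda>(k, i). k + i * r) (K \<times> {..<P})"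
    proof (rule inj_onI, clarsimp)
      fix k i k' i'
      assume k: "k \<in> K" "k' \<in> K" "i < P" "i' < P" and eq: "k + i * r = k' + i' * r"
      have "i = i'"
      proof (rule ccontr)
        assume "i \<noteq> i'"
        obtain p :: int where p: "\<bar>(real k - real k') * \<theta> - p\<bar> \<le> \<rho>" using close k by blast
        define u where "u = (real i' - real i) * (real s * (of_int q * \<theta> - of_int h))"
        define p' where "p' = p - (int i' - int i) * (int s * h)"
        have "real k + real i * real r = real k' + real i' * real r"
          using eq by (metis of_nat_add of_nat_mult)
        then have "real k - real k' = (real i' - real i) * real r" by (simp add: algebra_simps)
        then have "(real k - real k') * \<theta> = (real i' - real i) * (real r * \<theta>)" by simp
        then have up: "\<bar>u - p'\<bar> \<le> \<rho>"
          using p unfolding r by (simp add: u_def p'_def algebra_simps)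
        have absu: "\<bar>u\<bar> = \<bar>real i' - real i\<bar> * (real s * g)"
          by (simp add: u_def g_def abs_mult)
        have "1 * (real s * g) \<le> \<bar>u\<bar>" unfolding absu
          using \<open>i \<noteq> i'\<close> g0 by (intro mult_right_mono) auto
        then have "\<rho> < \<bar>u\<bar>" using s(1) by simp
        have "\<bar>u\<bar> \<le> real P * (2 * \<rho>)" unfolding absu
          using k g0 by (intro mult_mono[OF _ s(2)]) auto
        then have "\<bar>u\<bar> \<le> 1 / 2" using assms(3) by (simp add: mult_ac)
        \<comment> \<open>The integer \<open>p'\<close> is within
          \<open>\<rho> < \<bar>u\<bar> \<le> 1 / 2\<close> of \<open>u\<close>, so it is 0; but
          then \<open>\<bar>u\<bar> \<le> \<rho>\<close>.\<close>
        have "\<bar>of_int p' :: real\<bar> < 1" using up \<open>\<bar>u\<bar> \<le> 1 / 2\<close> \<open>\<rho> < \<bar>u\<bar>\<close> by linarith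
        then have "p' = 0" by linarith
        then show False using up \<open>\<rho> < \<bar>u\<bar>\<close> by simp
      qed
      then show "k = k' \<and> i = i'" using eq by simp
    qed
    moreover have "(\<lambda>(k, i). k + i * r) ` (K \<times> {..<P}) \<subseteq> {..N + P * r}"
      using K by (auto intro!: add_mono mult_right_mono)
    ultimately have "card (K \<times> {..<P}) \<le> card {..N + P * r}"
      by (rule card_inj_on_le) simp
    then show ?thesis by (simp add: card_cartesian_product mult.commute)
  qed
  then show ?thesis by (intro that[of "P * r + 1"]) blast
qed

subsection \<open>Binary digits of powers\<close>

text \<open>For \<open>\<theta> = log 2 \<beta>\<close>, \<open>2 powr frac (- (k * \<theta>))\<close> is the mantissa of \<open>inverse (\<beta> ^ k)\<close> in \<open>[1, 2)\<close>.
  Index \<open>0\<close> is the leading digit, in contrast to \<open>bin_digit\<close>.\<close>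

definition digit_prefix :: "real \<Rightarrow> nat \<Rightarrow> nat \<Rightarrow> nat set" where
  "digit_prefix \<theta> n k = {i\<in>{..<n}. odd \<lfloor>2 ^ i * 2 powr frac (- (real k * \<theta>))\<rfloor>}"

lemma digit_prefix_in_ap_free_sets:
  assumes "\<beta> > 1" "k \<ge> 1" "\<not> has_3AP (digit_one_set \<beta> k)"
  shows "digit_prefix (ln \<beta> / ln 2) n k \<in> ap_free_sets n"
proof -
  define t where "t = - (real k * (ln \<beta> / ln 2))"
  define x where "x = inverse (\<beta> ^ k)"
  have x: "x = 2 powr t"
    using assms(1) by (simp add: x_def t_def powr_def exp_minus exp_of_nat_mult)
  have "t < 0" unfolding t_def using assms(1,2) by simp
  then have x1: "x \<noteq> 1" and t: "\<lfloor>t\<rfloor> < 0"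
    using powr_less_mono[of t 0 "2::real"] unfolding x by auto
  \<comment> \<open>The position of the leading 1 of \<open>x\<close>. As \<open>k \<ge> 1\<close>,
    \<open>x \<noteq> 1\<close> and the special case of \<open>bin_digit\<close> does not
    arise.\<close>
  define m where "m = nat (- \<lfloor>t\<rfloor>)"
  have m: "1 \<le> m" "real m = - of_int \<lfloor>t\<rfloor>" using t by (simp_all add: m_def) linarith
  have shift: "2 ^ (m + i) * x = 2 ^ i * 2 powr frac t" for i
  proof -
    have "2 ^ (m + i) * x = 2 ^ i * (2 powr real m * 2 powr t)"
      by (simp add: x power_add powr_realpow)
    also have "2 powr real m * 2 powr t = 2 powr frac t"
      by (simp add: powr_add[symmetric] m(2) frac_def)
    finally show ?thesis .
  qed
  have "(\<lambda>j. m + j * 1) ` digit_prefix (ln \<beta> / ln 2) n k \<subseteq> digit_one_set \<beta> k"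
  proof (rule image_subsetI)
    fix i assume "i \<in> digit_prefix (ln \<beta> / ln 2) n k"
    then have "odd \<lfloor>2 ^ (m + i) * x\<rfloor>"
      unfolding digit_prefix_def shift t_def[symmetric] by simp
    then have "bin_digit x (m + i) = 1"
      unfolding bin_digit_def using x1 by (simp add: odd_iff_mod_2_eq_one)
    then show "m + i * 1 \<in> digit_one_set \<beta> k"
      unfolding digit_one_set_def x_def using m(1) by simp
  qed
  then have "\<not> has_3AP (digit_prefix (ln \<beta> / ln 2) n k)"
    using assms(3) has_3AP_mono[OF has_3AP_affine_image[OF _ order_refl]] by metis
  then show ?thesis by (auto simp: ap_free_sets_def digit_prefix_def)
qed

text \<open>Doubling appends one binary digit, so the parities of successive floors determine the
  floors.\<close>

lemma floor_double: "\<lfloor>2 * z\<rfloor> = 2 * \<lfloor>z::real\<rfloor> + (if odd \<lfloor>2 * z\<rfloor> then 1 else 0)"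
proof -
  have "\<lfloor>2 * z\<rfloor> = 2 * \<lfloor>z\<rfloor> \<or> \<lfloor>2 * z\<rfloor> = 2 * \<lfloor>z\<rfloor> + 1" by linarith
  then show ?thesis by (elim disjE) simp_all
qed

text \<open>Mantissas with the same first \<open>n\<close> digits differ by at most
  \<open>2 / 2 ^ n\<close>. As \<open>ln\<close> is 1-Lipschitz on \<open>[1, \<infinity>)\<close>
  and \<open>ln 2 \<ge> 1 / 2\<close>, their base-2 logarithms differ by at most twice that.\<close>

lemma digit_prefix_eq_imp_close:
  assumes "digit_prefix \<theta> n k = digit_prefix \<theta> n k'"
  shows "\<exists>p::int. \<bar>(real k - real k') * \<theta> - p\<bar> \<le> 4 / 2 ^ n"
proof (cases n)
  case 0
  have "\<bar>(real k - real k') * \<theta> - \<lfloor>(real k - real k') * \<theta>\<rfloor>\<bar> \<le> 4 / 2 ^ n"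
    unfolding 0 by simp linarith
  then show ?thesis by blast
next
  case (Suc n')
  define t t' where "t = - (real k * \<theta>)" and "t' = - (real k' * \<theta>)"
  define z z' where "z = (2::real) powr frac t" and "z' = (2::real) powr frac t'"
  have z1: "1 \<le> 2 powr frac u" "2 powr frac u < 2" for u :: real
    using powr_mono[of 0 "frac u" 2] powr_less_mono[of "frac u" 1 2] frac_lt_1[of u] by auto
  have odd: "odd \<lfloor>2 ^ i * z\<rfloor> = odd \<lfloor>2 ^ i * z'\<rfloor>" if "i < n" for i
    using assms that unfolding digit_prefix_def z_def z'_def t_def t'_def by blast
  have eq: "\<lfloor>2 ^ i * z\<rfloor> = \<lfloor>2 ^ i * z'\<rfloor>" if "i < n" for i
    using that
  proof (induction i)
    case 0
    have "\<lfloor>z\<rfloor> = 1" "\<lfloor>z'\<rfloor> = 1" using z1 unfolding z_def z'_def by (auto simp: floor_eq_iff)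
    then show ?case by simp
  next
    case (Suc i)
    then show ?case
      using floor_double[of "2 ^ i * z"] floor_double[of "2 ^ i * z'"] odd[of "Suc i"]
      by (simp add: mult.assoc)
  qed
  have "\<bar>2 ^ n' * z - 2 ^ n' * z'\<bar> < 1" using eq[of n'] Suc by linarith
  then have "2 ^ n' * \<bar>z - z'\<bar> < 1"
    by (simp add: right_diff_distrib[symmetric] abs_mult)
  then have dz: "\<bar>z - z'\<bar> \<le> 2 / 2 ^ n" using Suc by (simp add: field_simps)
  have ln_le: "ln u - ln v \<le> \<bar>u - v\<bar>" if "1 \<le> u" "1 \<le> v" for u v :: real
  proof -
    have "ln u - ln v \<le> (u - v) / v" using that by (intro ln_diff_le) auto
    also have "\<dots> \<le> \<bar>u - v\<bar> / v" using that by (intro divide_right_mono) auto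
    also have "\<dots> \<le> \<bar>u - v\<bar>" using that mult_left_mono[of 1 v "\<bar>u - v\<bar>"] by (simp add: divide_le_eq)
    finally show ?thesis .
  qed
  have "\<bar>ln z - ln z'\<bar> \<le> \<bar>z - z'\<bar>"
    using ln_le[of z z'] ln_le[of z' z] z1 unfolding z_def z'_def by (simp add: abs_minus_commute)
  moreover have "\<bar>ln z - ln z'\<bar> = \<bar>frac t - frac t'\<bar> * ln 2"
    by (simp add: z_def z'_def ln_powr left_diff_distrib[symmetric] abs_mult)
  moreover have "\<bar>frac t - frac t'\<bar> * (1 / 2) \<le> \<bar>frac t - frac t'\<bar> * ln 2"
    using ln_le_minus_one[of "1 / 2 :: real"] by (intro mult_left_mono) (auto simp: ln_div)
  ultimately have "\<bar>frac t - frac t'\<bar> \<le> 4 / 2 ^ n" using dz by simp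
  moreover have "\<bar>frac t - frac t'\<bar> = \<bar>(real k - real k') * \<theta> - of_int (\<lfloor>t'\<rfloor> - \<lfloor>t\<rfloor>)\<bar>"
    by (simp add: frac_def t_def t'_def algebra_simps abs_if)
  ultimately show ?thesis by (intro exI[of _ "\<lfloor>t'\<rfloor> - \<lfloor>t\<rfloor>"]) linarith
qed

section \<open>Counting the exponents in \<open>W\<close>\<close>

theorem theorem6p1:
  fixes \<beta> :: real
  assumes "\<beta> > 1" and "ln \<beta> / ln 2 \<notin> \<rat>"
  defines "W \<equiv> {k::nat. \<not> has_3AP (digit_one_set \<beta> k)}"
  shows "((\<lambda>N. real (card (W \<inter> {1..N})) / real N) \<longlonglongrightarrow> 0) \<and>
         (badly_approximable (ln \<beta> / ln 2) \<longrightarrow>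
           (\<forall>\<epsilon>>0. (\<lambda>N. real (card (W \<inter> {1..N}))) \<in> O(\<lambda>N. real N powr \<epsilon>)))"
proof (intro conjI impI allI)
  define \<theta> where "\<theta> = ln \<beta> / ln 2"
  have \<theta>: "\<theta> \<notin> \<rat>" "0 < \<theta>" using assms(1,2) by (auto simp: \<theta>_def)
  define V where "V N = W \<inter> {1..N}" for N
  have finV: "finite (V N)" and V1: "V N \<subseteq> {1..N}" for N by (auto simp: V_def)
  have prefix: "digit_prefix \<theta> n k \<in> ap_free_sets n" if "k \<in> V N" for n k N
    using that digit_prefix_in_ap_free_sets[OF assms(1)] by (auto simp: V_def W_def \<theta>_def)

  show "(\<lambda>N. real (card (W \<inter> {1..N})) / real N) \<longlonglongrightarrow> 0"
    unfolding V_def[symmetric]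
  proof (rule LIMSEQ_I)
    fix e :: real assume e: "0 < e"
    \<comment> \<open>Any exponent below 1 would do: each prefix is shared by a proportion of order
      \<open>2 powr (- n)\<close>.\<close>
    obtain C where C: "C > 0" "\<And>n. real (card (ap_free_sets n)) \<le> C * 2 powr (1 / 2 * n)"
      using card_ap_free_sets_le[of "1 / 2"] by auto
    have "(\<lambda>n. 16 * C * 2 powr (- (1 / 2) * real n)) \<longlonglongrightarrow> 0"
      by real_asymp
    then have "eventually (\<lambda>n. 16 * C * 2 powr (- (1 / 2) * real n) < e / 2) sequentially"
      using e by (intro order_tendstoD) auto
    then obtain m where m: "\<And>n. m \<le> n \<Longrightarrow> 16 * C * 2 powr (- (1 / 2) * real n) < e / 2"
      unfolding eventually_sequentially by blast
    \<comment> \<open>The offset 4 gives \<open>4 * \<rho> * P = 1\<close> for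
      \<open>\<rho> = 4 / 2 ^ n\<close> and \<open>P = 2 ^ m\<close>.\<close>
    define n where "n = m + 4"
    have n: "16 * C * 2 powr (- (1 / 2) * real n) < e / 2"
      by (rule m) (simp add: n_def)
    have "4 * (4 / 2 ^ n) * real (2 ^ m) \<le> 1" by (simp add: n_def power_add)
    then obtain J where J: "\<And>N K. K \<subseteq> {1..N} \<Longrightarrow>
      (\<And>k k'. k \<in> K \<Longrightarrow> k' \<in> K \<Longrightarrow> \<exists>p::int. \<bar>(real k - real k') * \<theta> - p\<bar> \<le> 4 / 2 ^ n) \<Longrightarrow>
        2 ^ m * card K \<le> N + J"
      using card_close_orbit_times[OF \<theta>(1), of "4 / 2 ^ n" "2 ^ m"]
      by (metis zero_less_divide_iff zero_less_numeral zero_less_power)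
    have le: "real (card (V N)) \<le> 16 * C * 2 powr (- (1 / 2) * real n) * (N + J)" for N
    proof -
      have "V N = (\<Union>S\<in>ap_free_sets n. {k \<in> V N. digit_prefix \<theta> n k = S})"
        using prefix by auto
      then have "card (V N) \<le> (\<Sum>S\<in>ap_free_sets n. card {k \<in> V N. digit_prefix \<theta> n k = S})"
        using card_UN_le[of "ap_free_sets n" "\<lambda>S. {k \<in> V N. digit_prefix \<theta> n k = S}"]
        by (simp add: finite_ap_free_sets)
      then have "2 ^ m * card (V N) \<le> (\<Sum>S\<in>ap_free_sets n. 2 ^ m * card {k \<in> V N. digit_prefix \<theta> n k = S})"
        by (simp add: sum_distrib_left[symmetric])
      also have "\<dots> \<le> (\<Sum>S\<in>ap_free_sets n. N + J)"
        using V1[of N] digit_prefix_eq_imp_close by (intro sum_mono J) blast+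
      finally have "real (2 ^ m * card (V N)) \<le> real (card (ap_free_sets n) * (N + J))"
        unfolding of_nat_le_iff by simp
      then have "2 ^ m * real (card (V N)) \<le> real (card (ap_free_sets n)) * (N + J)"
        by simp
      also have "\<dots> \<le> C * 2 powr (1 / 2 * n) * (N + J)"
        using C(2)[of n] by (intro mult_right_mono) auto
      finally have "real (card (V N)) \<le> C * 2 powr (1 / 2 * n) * (N + J) / 2 ^ m"
        by (simp add: field_simps)
      also have "2 powr (1 / 2 * n) = 2 powr (- (1 / 2) * real n) * 2 powr real n"
        by (simp add: powr_add[symmetric])
      also have "2 powr real n = 16 * 2 ^ m" by (simp add: n_def powr_realpow powr_add)
      finally show ?thesis by simp (simp add: algebra_simps)
    qed
    have "norm (real (card (V N)) / real N - 0) < e" if N: "N \<ge> Suc J" for N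
    proof -
      have "real (card (V N)) \<le> 16 * C * 2 powr (- (1 / 2) * real n) * (2 * N)"
        using le[of N] C(1) N by (elim order_trans) (intro mult_left_mono, auto)
      also have "\<dots> < e / 2 * (2 * N)"
        using N by (intro mult_strict_right_mono n) simp
      finally show ?thesis using N by (simp add: field_simps)
    qed
    then show "\<exists>N0. \<forall>N\<ge>N0. norm (real (card (V N)) / real N - 0) < e" by blast
  qed

  fix \<epsilon> :: real
  assume "badly_approximable (ln \<beta> / ln 2)" and \<epsilon>: "0 < \<epsilon>"
  then obtain c where c: "0 < c" "\<And>j p. 1 \<le> j \<Longrightarrow> c / real j \<le> \<bar>real j * \<theta> - of_int p\<bar>"
    using badly_approximable_lower_bound[OF \<theta>] unfolding \<theta>_def by blast
  obtain C where C: "C > 0" "\<And>n. real (card (ap_free_sets n)) \<le> C * 2 powr (\<epsilon> * n)"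
    using card_ap_free_sets_le[OF \<epsilon>] by blast
  \<comment> \<open>\<open>c' \<le> 1\<close> makes \<open>L\<close> below nonnegative, so
    \<open>nat\<close> does not truncate its floor.\<close>
  define c' where "c' = min c 1"
  have c': "0 < c'" "c' \<le> c" "c' \<le> 1" using c(1) by (auto simp: c'_def)
  have "real (card (V N)) \<le> C * (16 / c') powr \<epsilon> * real N powr \<epsilon>" if N: "N \<ge> 1" for N
  proof -
    define L where "L = log 2 (4 * N / c')"
    \<comment> \<open>The prefix is just long enough that \<open>4 / 2 ^ n < c' / N\<close>: equal
      prefixes would bring two multiples of \<open>\<theta>\<close> closer modulo 1 than bad
      approximability allows for differences up to \<open>N\<close>.\<close>
    define n where "n = nat \<lfloor>L\<rfloor> + 1"
    have q: "1 \<le> 4 * N / c'" using N c' by (simp add: field_simps)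
    then have "0 \<le> L" by (simp add: L_def)
    then have n: "L < real n" "real n \<le> L + 1" unfolding n_def by linarith+
    have L: "2 powr L = 4 * N / c'" using q unfolding L_def by (intro powr_log_cancel) auto
    have "4 * N / c' < 2 powr real n" unfolding L[symmetric] using n by simp
    then have small: "4 / 2 ^ n < c' / N"
      using c' N by (simp add: powr_realpow field_simps)
    have separated: False if kk': "k \<in> V N" "k' \<in> V N" "k' < k" "digit_prefix \<theta> n k = digit_prefix \<theta> n k'" for k k'
    proof -
      obtain p :: int where p: "\<bar>(real k - real k') * \<theta> - p\<bar> \<le> 4 / 2 ^ n"
        using digit_prefix_eq_imp_close kk'(4) by blast
      have "k - k' \<le> N" "1 \<le> k - k'" using kk' V1[of N] by fastforce+
      then have "c' / N \<le> c / real (k - k')"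
        using c' by (intro frac_le) auto
      also have "\<dots> \<le> \<bar>real (k - k') * \<theta> - p\<bar>" using c(2) \<open>1 \<le> k - k'\<close> by blast
      also have "\<dots> \<le> 4 / 2 ^ n" using p kk'(3) by (simp add: of_nat_diff)
      finally show False using small by simp
    qed
    have "inj_on (digit_prefix \<theta> n) (V N)"
      using separated by (intro inj_onI) (metis linorder_neqE_nat)
    then have "card (V N) \<le> card (ap_free_sets n)"
      using prefix by (intro card_inj_on_le finite_ap_free_sets) auto
    then have "real (card (V N)) \<le> C * 2 powr (\<epsilon> * n)" using C(2)[of n] by linarith
    also have "\<dots> \<le> C * 2 powr (\<epsilon> * (L + 2))"
      using C(1) \<epsilon> n by (intro mult_left_mono powr_mono) auto
    also have "2 powr (\<epsilon> * (L + 2)) = (2 powr L * 2 powr 2) powr \<epsilon>"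
      by (simp only: powr_add[symmetric] powr_powr) (simp add: mult.commute)
    also have "2 powr L * 2 powr 2 = 16 / c' * N" unfolding L by simp
    also have "(16 / c' * N) powr \<epsilon> = (16 / c') powr \<epsilon> * real N powr \<epsilon>"
      by (rule powr_mult)
    finally show ?thesis by (simp add: mult.assoc)
  qed
  then show "(\<lambda>N. real (card (W \<inter> {1..N}))) \<in> O(\<lambda>N. real N powr \<epsilon>)"
    unfolding V_def[symmetric]
    by (intro bigoI[of _ "C * (16 / c') powr \<epsilon>"]) (auto simp: eventually_sequentially)
qed

end
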